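(* Let $K$ be a field of characteristic $0$. Let $\sigma\in \mathrm{GA}_3(K)\setminus \mathrm{Aff}_3(K)$ be a non affine automorphism such that $\sigma(z)=z$ and $\sigma(y)\in \mathcal{R}^1(K[z])$. Then $\sigma$ is co-tame.
   Context: $\mathrm{GA}_3(K)$ is the group of automorphisms of the $K$-algebra $K[x,y,z]$. $\mathrm{Aff}_3(K)$ is the subgroup of affine automorphisms ($\sigma(x),\sigma(y),\sigma(z)$ all of degree $1$). $\mathrm{BA}_3(K)$ is the subgroup of triangular automorphisms ($\sigma(x)\in K^*x+K[y,z]$, $\sigma(y)\in K^*y+K[z]$, $\sigma(z)\in K^*z+K$). $\mathrm{TA}_3(K)$, the group of tame automorphisms, is the subgroup generated by $\mathrm{Aff}_3(K)$ and $\mathrm{BA}_3(K)$. An automorphism $\sigma\in \mathrm{GA}_3(K)$ is called co-tame if $\mathrm{TA}_3(K)$ is contained in the subgroup of $\mathrm{GA}_3(K)$ generated by $\mathrm{Aff}_3(K)$ and $\sigma$. $\mathcal{R}^1(K[z])$ is the set of polynomials $F\in K[z][x,y]=K[x,y,z]$ of the form $F=p_1x+Q_1(y)$ with $p_1\in K(z)\setminus\{0\}$ and $Q_1\in K(z)[y]$ (equivalently $p_1\in K[z]\setminus\{0\}$ and $Q_1\in K[z][y]$). *)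

theory Defs
  imports
    "HOL-Computational_Algebra.Polynomial_Factorial"
    "HOL-Algebra.Generated_Groups"
begin

text \<open>
  The ring \<open>K[x,y,z]\<close> is represented as \<open>K[z][y][x]\<close>: the outermost variable is \<open>x\<close>, the
  innermost one is \<open>z\<close>. Thus \<open>K[z]\<close>, \<open>K[y,z]\<close> and \<open>K[x,y,z]\<close> are the types \<open>'a poly\<close>,
  \<open>'a poly poly\<close> and \<open>'a poly poly poly\<close>, and each embeds into the next as the constant
  polynomials \<open>[:p:]\<close>.
\<close>

type_synonym 'a poly3 = "'a poly poly poly"

definition const3 :: "'a::field \<Rightarrow> 'a poly3"
  where "const3 c = [:[:[:c:]:]:]"

definition var_x :: "'a::field poly3"
  where "var_x = [:0, 1:]"

definition var_y :: "'a::field poly3"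
  where "var_y = [:[:0, 1:]:]"

definition var_z :: "'a::field poly3"
  where "var_z = [:[:[:0, 1:]:]:]"

text \<open>As for \<^const>\<open>degree\<close>, the total degree of the zero polynomial is \<open>0\<close>.\<close>

definition total_degree :: "'a::field poly3 \<Rightarrow> nat"
  where "total_degree p =
    (LEAST n. \<forall>i j k. i + j + k > n \<longrightarrow> coeff (coeff (coeff p i) j) k = 0)"

definition alg_automorphism :: "('a::field poly3 \<Rightarrow> 'a poly3) \<Rightarrow> bool"
  where "alg_automorphism \<sigma> \<longleftrightarrow>
    bij \<sigma> \<and>
    (\<forall>p q. \<sigma> (p + q) = \<sigma> p + \<sigma> q) \<and>
    (\<forall>p q. \<sigma> (p * q) = \<sigma> p * \<sigma> q) \<and>
    (\<forall>c. \<sigma> (const3 c) = const3 c)"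

definition GA3 :: "('a::field poly3 \<Rightarrow> 'a poly3) monoid"
  where "GA3 = \<lparr>carrier = {\<sigma>. alg_automorphism \<sigma>}, mult = (\<circ>), one = id\<rparr>"

definition Aff3 :: "('a::field poly3 \<Rightarrow> 'a poly3) set"
  where "Aff3 = {\<sigma> \<in> carrier GA3.
    total_degree (\<sigma> var_x) = 1 \<and> total_degree (\<sigma> var_y) = 1 \<and> total_degree (\<sigma> var_z) = 1}"

definition BA3 :: "('a::field poly3 \<Rightarrow> 'a poly3) set"
  where "BA3 = {\<sigma> \<in> carrier GA3.
    (\<exists>a (p :: 'a poly poly). a \<noteq> 0 \<and> \<sigma> var_x = const3 a * var_x + [:p:]) \<and>
    (\<exists>b (q :: 'a poly). b \<noteq> 0 \<and> \<sigma> var_y = const3 b * var_y + [:[:q:]:]) \<and>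
    (\<exists>c d. c \<noteq> 0 \<and> \<sigma> var_z = const3 c * var_z + const3 d)}"

definition TA3 :: "('a::field poly3 \<Rightarrow> 'a poly3) set"
  where "TA3 = generate GA3 (Aff3 \<union> BA3)"

definition co_tame :: "('a::field poly3 \<Rightarrow> 'a poly3) \<Rightarrow> bool"
  where "co_tame \<sigma> \<longleftrightarrow> \<sigma> \<in> carrier GA3 \<and> TA3 \<subseteq> generate GA3 (insert \<sigma> Aff3)"

definition R1 :: "'a::field poly3 set"
  where "R1 = {F. \<exists>(p :: 'a poly) (Q :: 'a poly poly). p \<noteq> 0 \<and> F = [:[:p:]:] * var_x + [:Q:]}"

text \<open>\<^const>\<open>R1\<close> does not change if the coefficients are allowed to lie in \<open>K(z)\<close>.\<close>

lemma R1_iff_fract: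
  fixes F :: "'a::field poly3"
  shows "F \<in> R1 \<longleftrightarrow>
    (\<exists>(p :: 'a poly fract) (Q :: 'a poly fract poly). p \<noteq> 0 \<and>
       map_poly (map_poly to_fract) F = [:[:p:]:] * [:0, 1:] + [:Q:])"
proof
  assume "F \<in> R1"
  then obtain p Q where pQ: "p \<noteq> 0" "F = [:[:p:]:] * var_x + [:Q:]"
    unfolding R1_def by blast
  have F: "F = [:Q, [:p:]:]"
    using pQ(2) by (simp add: var_x_def)
  have "map_poly to_fract [:p:] = [:to_fract p:]"
    by (rule poly_eqI) (simp add: coeff_map_poly coeff_pCons split: nat.split)
  then have "map_poly (map_poly to_fract) F = [:[:to_fract p:]:] * [:0, 1:] + [:map_poly to_fract Q:]"
    unfolding F using pQ(1) by (simp add: map_poly_pCons)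
  with pQ(1) show "\<exists>(p :: 'a poly fract) Q. p \<noteq> 0 \<and>
       map_poly (map_poly to_fract) F = [:[:p:]:] * [:0, 1:] + [:Q:]"
    by (metis to_fract_eq_0_iff)
next
  assume "\<exists>(p :: 'a poly fract) Q. p \<noteq> 0 \<and>
       map_poly (map_poly to_fract) F = [:[:p:]:] * [:0, 1:] + [:Q:]"
  then obtain p :: "'a poly fract" and Q where p: "p \<noteq> 0"
    and "map_poly (map_poly to_fract) F = [:[:p:]:] * [:0, 1:] + [:Q:]" by blast
  then have eq: "map_poly (map_poly to_fract) F = [:Q, [:p:]:]" by simp
  have c: "to_fract (coeff (coeff F i) j) = coeff (coeff [:Q, [:p:]:] i) j" for i j
    unfolding eq[symmetric] by (simp add: coeff_map_poly)
  have hi: "coeff F (Suc (Suc i)) = 0" for i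
    using c[of "Suc (Suc i)"] by (intro poly_eqI) simp
  have lin: "coeff F (Suc 0) = [:coeff (coeff F 1) 0:]"
  proof (rule poly_eqI)
    fix j
    show "coeff (coeff F (Suc 0)) j = coeff [:coeff (coeff F 1) 0:] j"
      using c[of 1 j] by (cases j) simp_all
  qed
  have "coeff (coeff F 1) 0 \<noteq> 0"
    using c[of 1 0] p by auto
  moreover have "F = [:coeff F 0, [:coeff (coeff F 1) 0:]:]"
  proof (rule poly_eqI)
    fix i
    consider "i = 0" | "i = Suc 0" | k where "i = Suc (Suc k)"
      by (metis not0_implies_Suc)
    then show "coeff F i = coeff [:coeff F 0, [:coeff (coeff F 1) 0:]:] i"
      using lin by cases (simp_all add: hi)
  qed
  then have "F = [:[:coeff (coeff F 1) 0:]:] * var_x + [:coeff F 0:]"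
    by (simp add: var_x_def)
  ultimately show "F \<in> R1"
    unfolding R1_def by blast
qed

lemma group_GA3: "group (GA3 :: ('a::field poly3 \<Rightarrow> 'a poly3) monoid)"
proof (rule groupI)
  fix \<sigma> :: "'a poly3 \<Rightarrow> 'a poly3"
  assume "\<sigma> \<in> carrier GA3"
  then have \<sigma>: "alg_automorphism \<sigma>" by (simp add: GA3_def)
  then have b: "bij \<sigma>" by (simp add: alg_automorphism_def)
  let ?i = "inv_into UNIV \<sigma>"
  have inv_eq: "\<sigma> p = q \<Longrightarrow> ?i q = p" for p q
    using b by (metis bij_inv_eq_iff)
  have surj: "\<sigma> (?i p) = p" for p
    using b by (metis bij_inv_eq_iff)
  have "alg_automorphism (?i)"
    using \<sigma> unfolding alg_automorphism_def
    by (auto intro!: inv_eq simp: surj bij_imp_bij_inv)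
  moreover have "?i \<circ> \<sigma> = id"
    using b by (simp add: bij_is_inj)
  ultimately show "\<exists>\<tau> \<in> carrier GA3. \<tau> \<otimes>\<^bsub>GA3\<^esub> \<sigma> = \<one>\<^bsub>GA3\<^esub>"
    by (auto simp: GA3_def)
qed (auto simp: GA3_def alg_automorphism_def intro: bij_comp)

end

theory Submission imports Defs begin

text \<open>
  Let \<open>H\<close> be a group containing the affine automorphisms, and let \<open>A\<close> be the set of those
  \<open>P \<in> K[y,z]\<close> for which the shear \<open>(x + P, y, z)\<close> is in \<open>H\<close>. It is a \<open>K\<close>-subspace invariant under
  affine substitutions in \<open>y, z\<close>, so it is spanned by monomials, and with \<open>y\<^sup>i z\<^sup>j\<close> it contains
  \<open>y\<^sup>i\<^sup>-\<^sup>1 z\<^sup>j\<close> and \<open>y\<^sup>i\<^sup>-\<^sup>1 z\<^sup>j\<^sup>+\<^sup>1\<close> (characteristic \<open>0\<close>). If some \<open>P \<in> A\<close> is not affine, then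
  \<open>z\<^sup>2 \<in> A\<close>, so \<open>A\<close> is also invariant under \<open>y \<mapsto> y + z\<^sup>2\<close>; this raises degrees, whence
  \<open>A = K[y,z]\<close> and \<open>H\<close> contains all tame automorphisms.

  To find a non-affine \<open>P\<close>, write \<open>\<sigma>(y) = p x + Q\<close> and conjugate \<open>t = (x + z, y, z)\<close> to
  \<open>\<sigma>\<^sup>-\<^sup>1 t \<sigma> = (u x + R(y,z), y + z p(z), z)\<close>. If \<open>p\<close> is not constant, conjugating \<open>(x + y, y, z)\<close>
  by this triangular map gives the shear with \<open>P = u (y - z p)\<close>. If \<open>p\<close> is constant, then
  \<open>\<sigma>(x) = u y + R(\<sigma>(y), z)\<close>, and the conjugate of \<open>t\<close> gives \<open>P = R(y + p z, z) - R(y, z)\<close>. This is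
  affine only if \<open>R = \<alpha> y + r(z)\<close>, in which case \<open>\<sigma>\<close> is triangular up to affine maps.
\<close>

subsection \<open>Substitution homomorphisms\<close>

text \<open>The extension of \<open>f\<close> to the polynomial ring given by its universal
  property, with the variable sent to \<open>t\<close>.\<close>

definition eval_map :: "('b::comm_ring_1 \<Rightarrow> 'c::comm_ring_1) \<Rightarrow> 'c \<Rightarrow> 'b poly \<Rightarrow> 'c"
  where "eval_map f t p = poly (map_poly f p) t"

definition ring_morphism :: "('b::comm_ring_1 \<Rightarrow> 'c::comm_ring_1) \<Rightarrow> bool"
  where "ring_morphism f \<longleftrightarrow>
    (\<forall>p q. f (p + q) = f p + f q) \<and> (\<forall>p q. f (p * q) = f p * f q) \<and> f 1 = 1"

lemma ring_morphism_add: "ring_morphism f \<Longrightarrow> f (p + q) = f p + f q"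
  and ring_morphism_mult: "ring_morphism f \<Longrightarrow> f (p * q) = f p * f q"
  and ring_morphism_1: "ring_morphism f \<Longrightarrow> f 1 = 1"
  by (simp_all add: ring_morphism_def)

lemma ring_morphism_0: "ring_morphism f \<Longrightarrow> f 0 = 0"
  using ring_morphism_add[of f 0 0] by simp

lemma ring_morphism_uminus: "ring_morphism f \<Longrightarrow> f (- p) = - f p"
  using ring_morphism_add[of f p "- p"] ring_morphism_0[of f] by (simp add: eq_neg_iff_add_eq_0 add.commute)

lemma ring_morphism_diff: "ring_morphism f \<Longrightarrow> f (p - q) = f p - f q"
  using ring_morphism_add[of f p "- q"] ring_morphism_uminus[of f q] by simp

lemma ring_morphism_power: "ring_morphism f \<Longrightarrow> f (p ^ n) = f p ^ n"
  by (induction n) (simp_all add: ring_morphism_1 ring_morphism_mult)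

lemmas ring_morphism_simps = ring_morphism_add ring_morphism_mult ring_morphism_1 ring_morphism_0
  ring_morphism_uminus ring_morphism_diff ring_morphism_power

lemma eval_map_pCons:
  "ring_morphism f \<Longrightarrow> eval_map f t (pCons a p) = f a + t * eval_map f t p"
  by (simp add: eval_map_def map_poly_pCons ring_morphism_0)

lemma eval_map_0: "eval_map f t 0 = 0"
  by (simp add: eval_map_def)

lemma eval_map_add:
  assumes "ring_morphism f"
  shows "eval_map f t (p + q) = eval_map f t p + eval_map f t q"
  by (induction p q rule: poly_induct2)
    (simp_all add: assms eval_map_pCons eval_map_0 ring_morphism_add algebra_simps)

lemma eval_map_smult:
  assumes "ring_morphism f"
  shows "eval_map f t (smult a p) = f a * eval_map f t p"
  by (induction p)
    (simp_all add: assms eval_map_pCons eval_map_0 ring_morphism_mult algebra_simps)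

lemma ring_morphism_eval_map:
  assumes f: "ring_morphism f"
  shows "ring_morphism (eval_map f t)"
proof -
  have "eval_map f t (p * q) = eval_map f t p * eval_map f t q" for p q
    by (induction p)
      (simp_all add: f eval_map_pCons eval_map_0 eval_map_add eval_map_smult ring_morphism_0 algebra_simps)
  moreover have "eval_map f t 1 = 1"
    by (simp add: one_pCons f eval_map_pCons eval_map_0 ring_morphism_1)
  ultimately show ?thesis
    by (simp add: ring_morphism_def eval_map_add[OF f])
qed

section \<open>Algebra endomorphisms and their determination by the images of the variables\<close>

definition alg_hom :: "('a::field poly3 \<Rightarrow> 'a poly3) \<Rightarrow> bool"
  where "alg_hom f \<longleftrightarrow> ring_morphism f \<and> (\<forall>c. f (const3 c) = const3 c)"

lemma const3_simps:
  "const3 0 = 0" "const3 1 = 1" "const3 (a + b) = const3 a + const3 b"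
  "const3 (a * b) = const3 a * const3 b" "const3 (- a) = - const3 a"
  "const3 (a - b) = const3 a - const3 b"
  by (simp_all add: const3_def one_pCons)

lemmas trivial_coeff_simps =
  const3_simps mult_1 mult_1_right mult_zero_left mult_zero_right add_0_left add_0_right

lemma ring_morphism_const3: "ring_morphism const3"
  by (simp add: ring_morphism_def const3_simps)

text \<open>The endomorphism \<open>x \<mapsto> f, y \<mapsto> g, z \<mapsto> h\<close>. The nesting
  mirrors \<open>K[z][y][x]\<close>: the innermost evaluation treats \<open>z\<close>.\<close>

definition subst3 :: "'a::field poly3 \<Rightarrow> 'a poly3 \<Rightarrow> 'a poly3 \<Rightarrow> 'a poly3 \<Rightarrow> 'a poly3"
  where "subst3 f g h = eval_map (eval_map (eval_map const3 h) g) f"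

lemma ring_morphism_subst3: "ring_morphism (subst3 f g h)"
  unfolding subst3_def by (intro ring_morphism_eval_map ring_morphism_const3)

lemma subst3_simps [simp]:
  "subst3 f g h (p + q) = subst3 f g h p + subst3 f g h q"
  "subst3 f g h (p * q) = subst3 f g h p * subst3 f g h q"
  "subst3 f g h (p - q) = subst3 f g h p - subst3 f g h q"
  "subst3 f g h (- p) = - subst3 f g h p"
  "subst3 f g h 0 = 0"
  "subst3 f g h 1 = 1"
  "subst3 f g h (p ^ n) = subst3 f g h p ^ n"
  using ring_morphism_simps[OF ring_morphism_subst3[of f g h]] by auto

lemma subst3_inner2: "subst3 f g h [:[:q:]:] = eval_map const3 h q"
  by (simp_all add: subst3_def eval_map_pCons eval_map_0 ring_morphism_eval_map ring_morphism_const3)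

lemma subst3_const3 [simp]: "subst3 f g h (const3 c) = const3 c"
  by (simp add: const3_def[of c] subst3_inner2 eval_map_pCons eval_map_0 ring_morphism_const3)

lemma subst3_var [simp]:
  "subst3 f g h var_x = f" "subst3 f g h var_y = g" "subst3 f g h var_z = h"
  by (simp_all add: var_x_def var_y_def var_z_def subst3_def eval_map_pCons eval_map_0
      ring_morphism_eval_map ring_morphism_const3 ring_morphism_simps const3_simps)
   
lemma alg_hom_subst3: "alg_hom (subst3 f g h)"
  by (simp add: alg_hom_def ring_morphism_subst3)

lemma alg_hom_comp: "alg_hom f \<Longrightarrow> alg_hom g \<Longrightarrow> alg_hom (f \<circ> g)"
  and alg_hom_id: "alg_hom id"
  by (simp_all add: alg_hom_def ring_morphism_def)

lemma alg_hom_morphism: "alg_hom f \<Longrightarrow> ring_morphism f"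
  and alg_hom_const3: "alg_hom f \<Longrightarrow> f (const3 c) = const3 c"
  by (simp_all add: alg_hom_def)

lemmas alg_hom_simps = ring_morphism_simps[OF alg_hom_morphism] alg_hom_const3

lemma alg_hom_pCons:
  assumes f: "alg_hom f"
  shows "f (pCons P p) = f [:P:] + f var_x * f p"
    and "f [:pCons q Q:] = f [:[:q:]:] + f var_y * f [:Q:]"
    and "f [:[:pCons c r:]:] = const3 c + f var_z * f [:[:r:]:]"
proof -
  have "pCons P p = [:P:] + var_x * p" "[:pCons q Q:] = [:[:q:]:] + var_y * [:Q:]"
    "[:[:pCons c r:]:] = const3 c + var_z * [:[:r:]:]"
    by (simp_all add: var_x_def var_y_def var_z_def const3_def)
  then show "f (pCons P p) = f [:P:] + f var_x * f p"
    and "f [:pCons q Q:] = f [:[:q:]:] + f var_y * f [:Q:]"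
    and "f [:[:pCons c r:]:] = const3 c + f var_z * f [:[:r:]:]"
    by (simp_all only: alg_hom_simps[OF f])
qed

text \<open>Horner's scheme on \<open>K[z]\<close> involves only the image of \<open>z\<close>.
  Uniqueness is stated layer by layer because many maps below agree only at \<open>z\<close>, or
  only at \<open>y\<close> and \<open>z\<close>.\<close>

lemma alg_hom_eq_inner2:
  assumes f: "alg_hom f" and g: "alg_hom g" and z: "f var_z = g var_z"
  shows "f [:[:r:]:] = g [:[:r:]:]"
proof (induction r)
  case 0
  show ?case by (simp add: alg_hom_simps[OF f] alg_hom_simps[OF g])
next
  case (pCons c r)
  then show ?case by (simp only: alg_hom_pCons(3)[OF f] alg_hom_pCons(3)[OF g] z)
qed

lemma alg_hom_eq_inner:
  assumes f: "alg_hom f" and g: "alg_hom g" and z: "f var_z = g var_z" and y: "f var_y = g var_y"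
  shows "f [:P:] = g [:P:]"
proof (induction P)
  case 0
  show ?case by (simp add: alg_hom_simps[OF f] alg_hom_simps[OF g])
next
  case (pCons q Q)
  then show ?case
    by (metis alg_hom_pCons(2)[OF f] alg_hom_pCons(2)[OF g] y alg_hom_eq_inner2[OF f g z])
qed

lemma alg_hom_eqI:
  assumes f: "alg_hom f" and g: "alg_hom g"
    and x: "f var_x = g var_x" and y: "f var_y = g var_y" and z: "f var_z = g var_z"
  shows "f = g"
proof
  fix p show "f p = g p"
  proof (induction p)
    case 0
    show ?case by (simp add: alg_hom_simps[OF f] alg_hom_simps[OF g])
  next
    case (pCons P p)
    then show ?case
      by (metis alg_hom_pCons(1)[OF f] alg_hom_pCons(1)[OF g] x alg_hom_eq_inner[OF f g z y])
  qed
qed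

lemma subst3_fix_inner2 [simp]: "subst3 f g var_z [:[:r:]:] = [:[:r:]:]"
  using alg_hom_eq_inner2[OF alg_hom_subst3 alg_hom_id, of f g var_z r] by simp

lemma subst3_fix_inner [simp]: "subst3 f var_y var_z [:P:] = [:P:]"
  using alg_hom_eq_inner[OF alg_hom_subst3 alg_hom_id, of f var_y var_z P] by simp

lemma subst3_pcompose:
  "subst3 f [:g:] var_z [:P:] = [:pcompose P g:]"
proof (induction P)
  case 0
  show ?case by simp
next
  case (pCons q Q)
  then show ?case
    by (subst alg_hom_pCons(2)[OF alg_hom_subst3]) (simp add: pcompose_pCons)
qed

text \<open>Exchanging \<open>y\<close> and \<open>z\<close> turns \<open>r(z) y^i\<close> into
  \<open>r(y) z^i\<close>, so each coefficient \<open>c\<close> of \<open>r\<close> becomes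
  \<open>c z^i\<close>.\<close>

lemma swap_yz_monom:
  fixes f :: "'a::field poly3"
  shows "subst3 f var_z var_y [:monom r i:] = [:map_poly (\<lambda>c. monom c i) r:]"
proof (induction r)
  case 0
  show ?case by simp
next
  case (pCons c r)
  have y: "var_y ^ i = ([:monom 1 i:] :: 'a poly3)" and z: "var_z ^ i = ([:[:monom 1 i:]:] :: 'a poly3)"
    by (simp_all add: var_y_def var_z_def poly_const_pow monom_altdef)
  have "[:monom (pCons c r) i:] = const3 c * var_y ^ i + var_z * [:monom r i:]"
    unfolding y by (simp add: const3_def var_z_def smult_monom add_monom)
  moreover have "[:map_poly (\<lambda>c. monom c i) (pCons c r):]
      = const3 c * var_z ^ i + var_y * [:map_poly (\<lambda>c. monom c i) r:]"
    unfolding z by (simp add: const3_def var_y_def smult_monom map_poly_pCons)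
  ultimately show ?case
    by (simp only: subst3_simps subst3_const3 subst3_var pCons.IH)
qed

subsection \<open>Automorphisms and affine automorphisms\<close>

lemma alg_automorphism_iff: "alg_automorphism f \<longleftrightarrow> bij f \<and> alg_hom f"
proof -
  have "f 1 = 1" if "\<forall>c. f (const3 c) = const3 c"
    using that[rule_format, of 1] by (simp add: const3_simps)
  then show ?thesis
    unfolding alg_automorphism_def alg_hom_def ring_morphism_def by auto
qed

lemma GA3_iff: "f \<in> carrier GA3 \<longleftrightarrow> bij f \<and> alg_hom f"
  by (simp add: GA3_def alg_automorphism_iff)

text \<open>The second substitution is a two-sided inverse, since both composites fix the
  variables.\<close>

lemma subst3_GA3I:
  fixes f g h f' g' h' :: "'a::field poly3"
  assumes "subst3 f g h f' = var_x" "subst3 f g h g' = var_y" "subst3 f g h h' = var_z"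
    and "subst3 f' g' h' f = var_x" "subst3 f' g' h' g = var_y" "subst3 f' g' h' h = var_z"
  shows "subst3 f g h \<in> carrier GA3"
proof -
  have "subst3 f g h \<circ> subst3 f' g' h' = id" "subst3 f' g' h' \<circ> subst3 f g h = id"
    by (rule alg_hom_eqI; simp add: assms alg_hom_comp alg_hom_subst3 alg_hom_id)+
  then show ?thesis
    by (simp add: GA3_iff alg_hom_subst3 o_bij)
qed

section \<open>Affine polynomials and the standard affine automorphisms\<close>

definition lin3 :: "'a::field \<Rightarrow> 'a \<Rightarrow> 'a \<Rightarrow> 'a \<Rightarrow> 'a poly3"
  where "lin3 a b c d = const3 a * var_x + const3 b * var_y + const3 c * var_z + const3 d"

lemma lin3_eq: "lin3 a b c d = [:[:[:d, c:], [:b:]:], [:[:a:]:]:]"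
  by (simp add: lin3_def const3_def var_x_def var_y_def var_z_def)

lemma total_degree_lin3:
  assumes "\<not> (a = 0 \<and> b = 0 \<and> c = 0)"
  shows "total_degree (lin3 a b c d) = 1"
  unfolding total_degree_def
proof (rule Least_equality)
  show "\<forall>i j k. i + j + k > 1 \<longrightarrow> coeff (coeff (coeff (lin3 a b c d) i) j) k = 0"
    by (auto simp: lin3_eq coeff_pCons split: nat.split)
next
  fix n assume *: "\<forall>i j k. i + j + k > n \<longrightarrow> coeff (coeff (coeff (lin3 a b c d) i) j) k = 0"
  show "1 \<le> n"
  proof (rule ccontr)
    assume "\<not> 1 \<le> n"
    then have "n = 0" by simp
    with *[rule_format, of 1 0 0] *[rule_format, of 0 1 0] *[rule_format, of 0 0 1] assms
    show False by (simp add: lin3_eq)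
  qed
qed

text \<open>\<open>Aff3\<close> asks for degree exactly 1, while a \<open>lin3\<close> form may be
  constant. Injectivity excludes this: a constant is already the image of itself.\<close>

lemma Aff3I:
  assumes f: "f \<in> carrier GA3"
    and "f var_x \<in> {lin3 a b c d |a b c d. True}"
    and "f var_y \<in> {lin3 a b c d |a b c d. True}"
    and "f var_z \<in> {lin3 a b c d |a b c d. True}"
  shows "f \<in> Aff3"
proof -
  have *: "total_degree (f v) = 1" if v: "f v \<in> {lin3 a b c d |a b c d. True}" "\<And>d. v \<noteq> const3 d" for v
  proof -
    obtain a b c d where e: "f v = lin3 a b c d" using v by blast
    have "\<not> (a = 0 \<and> b = 0 \<and> c = 0)"
    proof
      assume "a = 0 \<and> b = 0 \<and> c = 0"
      then have "f v = f (const3 d)"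
        using e f by (simp add: lin3_def const3_simps GA3_iff alg_hom_def)
      then show False using f v(2) by (auto simp: GA3_iff bij_def inj_eq)
    qed
    then show ?thesis by (simp add: e total_degree_lin3)
  qed
  have "var_x \<noteq> const3 d" "var_y \<noteq> const3 d" "var_z \<noteq> const3 d" for d :: 'a
    by (auto simp: var_x_def var_y_def var_z_def const3_def)
  then show ?thesis
    using assms * by (auto simp: Aff3_def)
qed

lemma const3_inverse: "c \<noteq> 0 \<Longrightarrow> const3 c * const3 (inverse c) = 1"
  "c \<noteq> 0 \<Longrightarrow> const3 (inverse c) * const3 c = 1"
  by (simp_all add: const3_simps flip: const3_simps(4))

lemma const3_inverse': "c \<noteq> 0 \<Longrightarrow> const3 c * (const3 (inverse c) * p) = p"
  "c \<noteq> 0 \<Longrightarrow> const3 (inverse c) * (const3 c * p) = p"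
  by (simp_all add: const3_inverse flip: mult.assoc)

lemma Aff3_subst3I:
  fixes f g h f' g' h' :: "'a::field poly3"
  assumes "subst3 f g h f' = var_x" "subst3 f g h g' = var_y" "subst3 f g h h' = var_z"
    and "subst3 f' g' h' f = var_x" "subst3 f' g' h' g = var_y" "subst3 f' g' h' h = var_z"
    and "f = lin3 a b c d" "g = lin3 a1 b1 c1 d1" "h = lin3 a2 b2 c2 d2"
  shows "subst3 f g h \<in> Aff3"
proof -
  have "subst3 f g h \<in> carrier GA3" by (rule subst3_GA3I[OF assms(1-6)])
  then show ?thesis by (rule Aff3I) (use assms(7-9) in auto)
qed

lemma Aff3_swap_xy: "subst3 var_y var_x var_z \<in> (Aff3 :: ('a::field poly3 \<Rightarrow> 'a poly3) set)"
  by (rule Aff3_subst3I[of _ _ _ var_y var_x var_z 0 1 0 0 1 0 0 0 0 0 1 0])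
    (simp_all add: lin3_def const3_simps)

lemma Aff3_swap_yz: "subst3 var_x var_z var_y \<in> (Aff3 :: ('a::field poly3 \<Rightarrow> 'a poly3) set)"
  by (rule Aff3_subst3I[of _ _ _ var_x var_z var_y 1 0 0 0 0 0 1 0 0 1 0 0])
    (simp_all add: lin3_def const3_simps)

lemma Aff3_diag:
  assumes "a \<noteq> 0" "b \<noteq> 0" "c \<noteq> 0"
  shows "subst3 (const3 a * var_x) (const3 b * var_y) (const3 c * var_z + const3 d) \<in> Aff3"
  by (rule Aff3_subst3I[of _ _ _ "const3 (inverse a) * var_x" "const3 (inverse b) * var_y"
        "const3 (inverse c) * (var_z - const3 d)" a 0 0 0 0 b 0 0 0 0 c d])
    (simp_all add: lin3_def const3_simps(1) const3_inverse' assms)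

lemma Aff3_add_x:
  "subst3 (var_x + const3 b * var_y + const3 c * var_z + const3 d) var_y var_z \<in> Aff3"
  by (rule Aff3_subst3I[of _ _ _ "var_x - const3 b * var_y - const3 c * var_z - const3 d" var_y var_z
        1 b c d 0 1 0 0 0 0 1 0])
    (simp_all add: lin3_def const3_simps)

lemma Aff3_add_y: "subst3 var_x (var_y + const3 c * var_z + const3 d) var_z \<in> Aff3"
  by (rule Aff3_subst3I[of _ _ _ var_x "var_y - const3 c * var_z - const3 d" var_z
        1 0 0 0 0 1 c d 0 0 1 0])
    (simp_all add: lin3_def const3_simps)

text \<open>Over the domain \<open>K[y,z]\<close>, \<open>f\<close> is composition with
  \<open>f(x)\<close>. A preimage \<open>q\<close> of \<open>x\<close> gives
  \<open>q(f(x)) = x\<close>; degrees in \<open>x\<close> multiply, so both are 1, and the leading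
  coefficients are mutually inverse units of \<open>K[y,z]\<close>, hence constants.\<close>

lemma fix_yz_imp_linear:
  fixes f :: "'a::field poly3 \<Rightarrow> 'a poly3"
  assumes f: "f \<in> carrier GA3" and y: "f var_y = var_y" and z: "f var_z = var_z"
  obtains u R where "u \<noteq> 0" "f var_x = const3 u * var_x + [:R:]"
proof -
  have hom: "alg_hom f" and "bij f" using f by (simp_all add: GA3_iff)
  have inner: "f [:P:] = [:P:]" for P
    using alg_hom_eq_inner[OF hom alg_hom_id] y z by simp
  have comp: "f p = pcompose p (f var_x)" for p
  proof (induction p)
    case 0
    show ?case by (simp add: alg_hom_simps[OF hom])
  next
    case (pCons P p)
    then show ?case by (subst alg_hom_pCons(1)[OF hom]) (simp add: inner pcompose_pCons)
  qed
  obtain q where q: "f q = var_x" using \<open>bij f\<close> by (metis bij_pointE)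
  have "degree q * degree (f var_x) = 1"
    using q comp[of q] degree_pcompose[of q "f var_x"] by (simp add: var_x_def)
  then have d1: "degree q = 1" "degree (f var_x) = 1" by auto
  obtain q0 q1 where q': "q = [:q0, q1:]" using degree1_coeffs[OF d1(1)] by blast
  obtain R r1 where r: "f var_x = [:R, r1:]" using degree1_coeffs[OF d1(2)] by blast
  have "pcompose [:q0, q1:] [:R, r1:] = var_x"
    using comp[of q] q q' r by metis
  then have "q1 * r1 = 1"
    by (simp add: pcompose_pCons var_x_def mult.commute)
  then have "is_unit r1" by (metis dvd_triv_right)
  then obtain u where "u \<noteq> 0" "r1 = [:[:u:]:]"
    by (auto simp: is_unit_poly_iff dvd_field_iff)
  then have "f var_x = const3 u * var_x + [:R:]"
    unfolding r by (simp add: const3_def var_x_def)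
  with \<open>u \<noteq> 0\<close> that show thesis by blast
qed

subsection \<open>Groups of automorphisms containing the affine ones\<close>

text \<open>Besides the group generated by \<open>\<sigma>\<close> and \<open>Aff3\<close>, the
  whole of \<open>GA3\<close> is an instance, which makes the cancellation lemmas available for
  arbitrary automorphisms.\<close>

locale affine_overgroup =
  fixes H :: "('a::field_char_0 poly3 \<Rightarrow> 'a poly3) set"
  assumes subgroup_H: "subgroup H GA3"
    and Aff3_subset: "Aff3 \<subseteq> H"
begin

lemma mem_GA3: "f \<in> H \<Longrightarrow> f \<in> carrier GA3"
  using subgroup.subset[OF subgroup_H] by blast

lemma mem_alg_hom: "f \<in> H \<Longrightarrow> alg_hom f"
  using mem_GA3 by (simp add: GA3_iff)

lemma comp_mem: "f \<in> H \<Longrightarrow> g \<in> H \<Longrightarrow> f \<circ> g \<in> H"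
  using subgroup.m_closed[OF subgroup_H, of f g] by (simp add: GA3_def)

lemma mem_by_comp:
  assumes "f \<in> H" "g \<in> H" "alg_hom h"
    and "h var_x = f (g var_x)" "h var_y = f (g var_y)" "h var_z = f (g var_z)"
  shows "h \<in> H"
proof -
  have "h = f \<circ> g"
    by (rule alg_hom_eqI) (simp_all add: assms alg_hom_comp mem_alg_hom)
  then show ?thesis using comp_mem assms by simp
qed

lemma left_quotient:
  assumes f: "f \<in> H" and g: "g \<in> H"
  obtains k where "k \<in> H" "\<And>p. f (k p) = g p"
proof -
  interpret G: group "GA3 :: ('a poly3 \<Rightarrow> 'a poly3) monoid" by (rule group_GA3)
  let ?k = "inv\<^bsub>GA3\<^esub> f"
  have k: "?k \<in> H" using f subgroup.m_inv_closed[OF subgroup_H] by blast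
  have "f \<circ> ?k = id" using G.r_inv[OF mem_GA3[OF f]] by (simp add: GA3_def)
  then have "f ((?k \<circ> g) p) = g p" for p by (simp add: pointfree_idE)
  with comp_mem[OF k g] that show thesis by blast
qed

lemma mem_inj: "f \<in> H \<Longrightarrow> f p = f q \<Longrightarrow> p = q"
  using mem_GA3 by (auto simp: GA3_iff bij_def inj_eq)

text \<open>Here \<open>h\<close> is the quotient of \<open>g\<close> by \<open>f\<close> on the
  left; comparing values on the variables avoids computing the inverse of \<open>f\<close>.\<close>

lemma mem_by_left_cancel:
  assumes f: "f \<in> H" and g: "g \<in> H" and h: "alg_hom h"
    and "f (h var_x) = g var_x" "f (h var_y) = g var_y" "f (h var_z) = g var_z"
  shows "h \<in> H"
proof -
  obtain k where k: "k \<in> H" "\<And>p. f (k p) = g p"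
    using left_quotient[OF f g] by blast
  have "h = k"
    by (rule alg_hom_eqI[OF h mem_alg_hom[OF k(1)]]) (rule mem_inj[OF f], simp add: assms k)+
  then show ?thesis using k by simp
qed

text \<open>The equations say that \<open>h \<circ> s = s \<circ> f\<close>, so \<open>h\<close> is
  a conjugate of \<open>f\<close>; no formula for the inverse of \<open>s\<close> is needed.\<close>

lemma mem_by_conjugation:
  assumes s: "s \<in> H" and f: "f \<in> H" and h: "alg_hom h"
    and "h (s var_x) = s (f var_x)" "h (s var_y) = s (f var_y)" "h (s var_z) = s (f var_z)"
  shows "h \<in> H"
proof -
  have hs: "h \<circ> s = s \<circ> f"
    by (rule alg_hom_eqI) (simp_all add: assms alg_hom_comp mem_alg_hom)
  interpret G: group "GA3 :: ('a poly3 \<Rightarrow> 'a poly3) monoid" by (rule group_GA3)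
  let ?k = "inv\<^bsub>GA3\<^esub> s"
  have k: "?k \<in> H" using s subgroup.m_inv_closed[OF subgroup_H] by blast
  have "s \<circ> ?k = id" using G.r_inv[OF mem_GA3[OF s]] by (simp add: GA3_def)
  then have "s \<circ> f \<circ> ?k = h" unfolding hs[symmetric] by (simp add: comp_assoc)
  then show ?thesis using comp_mem[OF comp_mem[OF s f] k] by simp
qed

section \<open>The space of shears in \<open>x\<close> and its closure properties\<close>

definition shears :: "'a poly poly set"
  where "shears = {P. subst3 (var_x + [:P:]) var_y var_z \<in> H}"

lemma shears_add:
  assumes "P \<in> shears" "Q \<in> shears"
  shows "P + Q \<in> shears"
proof -
  have e: "[:P + Q:] = [:P:] + [:Q:]" by simp
  have "subst3 (var_x + [:P + Q:]) var_y var_z \<in> H"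
    unfolding e
    by (rule mem_by_comp[of "subst3 (var_x + [:P:]) var_y var_z" "subst3 (var_x + [:Q:]) var_y var_z"])
      (use assms in \<open>simp_all only: shears_def mem_Collect_eq alg_hom_subst3 subst3_simps subst3_var
        subst3_fix_inner add.assoc\<close>)
  then show ?thesis by (simp add: shears_def)
qed

text \<open>Conjugation by the dilation \<open>x \<mapsto> x/c\<close> rescales the shear; for
  \<open>c = 0\<close> the shear is the identity.\<close>

lemma shears_smult:
  assumes P: "P \<in> shears"
  shows "smult [:c:] P \<in> shears"
proof (cases "c = 0")
  case True
  have "subst3 (var_x + const3 0 * var_y + const3 0 * var_z + const3 0) var_y var_z \<in> H"
    using Aff3_add_x Aff3_subset by blast
  then show ?thesis by (simp add: shears_def True const3_simps)
next
  case False
  have "subst3 (const3 (inverse c) * var_x) (const3 1 * var_y) (const3 1 * var_z + const3 0) \<in> H"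
    using Aff3_diag[of "inverse c" 1 1 0] False Aff3_subset by auto
  then have s: "subst3 (const3 (inverse c) * var_x) var_y var_z \<in> H"
    by (simp add: const3_simps)
  have e: "[:smult [:c:] P:] = const3 c * [:P:]" by (simp add: const3_def)
  from P have P': "subst3 (var_x + [:P:]) var_y var_z \<in> H" by (simp add: shears_def)
  have "const3 (inverse c) * (var_x + const3 c * [:P:]) = const3 (inverse c) * var_x + [:P:]"
    using False by (simp only: distrib_left const3_inverse' not_False_eq_True)
  then have "subst3 (var_x + const3 c * [:P:]) var_y var_z \<in> H"
    by (intro mem_by_conjugation[OF s P'])
      (simp_all only: subst3_simps subst3_var subst3_const3 subst3_fix_inner alg_hom_subst3)
  then show ?thesis by (simp only: shears_def mem_Collect_eq e)
qed

text \<open>The substitution fixes \<open>x\<close> and preserves \<open>K[y,z]\<close>, where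
  shears act trivially; conjugating by it therefore only transforms \<open>P\<close>.\<close>

lemma shears_substitute:
  assumes "P \<in> shears" and s: "subst3 var_x [:g:] [:h:] \<in> H"
    and "subst3 var_x [:g:] [:h:] [:P:] = [:Q:]"
  shows "Q \<in> shears"
proof -
  have P: "subst3 (var_x + [:P:]) var_y var_z \<in> H" using assms(1) by (simp add: shears_def)
  have "subst3 (var_x + [:Q:]) var_y var_z \<in> H"
    by (rule mem_by_conjugation[OF s P])
      (simp_all only: alg_hom_subst3 subst3_simps subst3_var subst3_fix_inner assms(3))
  then show ?thesis by (simp add: shears_def)
qed

lemma shears_diff: "P \<in> shears \<Longrightarrow> Q \<in> shears \<Longrightarrow> P - Q \<in> shears"
proof -
  assume "P \<in> shears" "Q \<in> shears"
  then have "P + smult [:-1:] Q \<in> shears" by (intro shears_add shears_smult)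
  moreover have "smult [:-1:] Q = - Q" by (rule poly_eqI) simp
  ultimately show ?thesis by simp
qed

lemma shears_0: "P \<in> shears \<Longrightarrow> 0 \<in> shears"
  using shears_diff[of P P] by simp

lemma shears_sum:
  assumes "0 \<in> shears" "\<And>i. i \<in> I \<Longrightarrow> P i \<in> shears"
  shows "(\<Sum>i\<in>I. P i) \<in> shears"
  using assms(2) by (induction I rule: infinite_finite_induct) (auto simp: assms(1) shears_add)

lemma shears_pcompose:
  assumes "P \<in> shears" and "subst3 var_x [:g:] var_z \<in> H"
  shows "pcompose P g \<in> shears"
  using shears_substitute[OF assms(1), of g "[:[:0, 1:]:]"] assms(2) subst3_pcompose[of var_x g P]
  unfolding var_z_def by blast

text \<open>Dilating \<open>y\<close> by \<open>2\<close> separates the powers of \<open>y\<close>, as \<open>2^i \<noteq> 2^n\<close> for \<open>i \<noteq> n\<close>.\<close>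

lemma shears_component:
  assumes "P \<in> shears"
  shows "monom (coeff P i) i \<in> shears"
  using assms
proof (induction "degree P" arbitrary: P i rule: less_induct)
  case less
  let ?n = "degree P"
  let ?g = "[:0, [:2:]:] :: 'a poly poly"
  have "subst3 (const3 1 * var_x) (const3 2 * var_y) (const3 1 * var_z + const3 0) \<in> H"
    using Aff3_diag[of 1 "2 :: 'a" 1 0] Aff3_subset by auto
  moreover have "[:?g:] = const3 2 * var_y" by (simp add: const3_def var_y_def)
  ultimately have "subst3 var_x [:?g:] var_z \<in> H"
    by (simp only: const3_simps(1,2) mult_1 add_0_right)
  then have dil: "pcompose P ?g \<in> shears" by (rule shears_pcompose[OF less.prems])
  have coeff_dil: "coeff (pcompose P ?g) k = [:2 ^ k:] * coeff P k" for k
    by (simp add: coeff_pcompose_linear poly_const_pow)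
  have "0 \<in> shears" by (rule shears_0[OF less.prems])
  have lower: "monom (coeff P k) k \<in> shears" if "k < ?n" for k
  proof -
    \<comment> \<open>The coefficient of \<open>y^j\<close> is multiplied by
      \<open>2^j - 2^n\<close>: the top one disappears, so induction applies, and the lower ones
      survive up to nonzero factors.\<close>
    define Q where "Q = pcompose P ?g - smult [:2 ^ ?n:] P"
    have Q: "Q \<in> shears" unfolding Q_def by (intro shears_diff shears_smult dil less.prems)
    have cQ: "coeff Q j = [:2 ^ j - 2 ^ ?n:] * coeff P j" for j
      unfolding Q_def coeff_diff coeff_dil by (simp add: smult_diff_left)
    have "degree Q < ?n"
    proof (rule degree_lessI)
      show "Q \<noteq> 0 \<or> ?n > 0" using that by simp
      show "\<forall>j\<ge>?n. coeff Q j = 0"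
        by (auto simp: cQ coeff_eq_0 le_less)
    qed
    then have "monom (coeff Q k) k \<in> shears" using less.hyps Q by blast
    then have in_shears: "smult [:inverse d:] (monom (coeff Q k) k) \<in> shears" for d
      by (rule shears_smult)
    have scale: "d \<noteq> 0 \<Longrightarrow> smult [:inverse d:] (monom ([:d:] * c) k) = monom c k" for d :: 'a and c
      by (simp add: smult_monom)
    \<comment> \<open>Passing through \<open>of_nat\<close> reduces the inequality to natural
      numbers, by characteristic 0.\<close>
    have "(of_nat (2 ^ k) :: 'a) \<noteq> of_nat (2 ^ ?n)"
      using that by (simp only: of_nat_eq_iff) simp
    then have "(2 ^ k - 2 ^ ?n :: 'a) \<noteq> 0"
      by (simp only: of_nat_power of_nat_numeral right_minus_eq not_False_eq_True)
    from scale[OF this, of "coeff P k"] in_shears show ?thesis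
      unfolding cQ by metis
  qed
  have "P = (\<Sum>k<?n. monom (coeff P k) k) + monom (coeff P ?n) ?n"
    using poly_as_sum_of_monoms[of P] by (simp add: lessThan_Suc_atMost[symmetric] del: lessThan_Suc_atMost)
  then have "monom (coeff P ?n) ?n = P - (\<Sum>k<?n. monom (coeff P k) k)"
    by (metis add_diff_cancel_left')
  also have "\<dots> \<in> shears"
    by (intro shears_diff less.prems shears_sum \<open>0 \<in> shears\<close>) (auto intro: lower)
  finally have top: "monom (coeff P ?n) ?n \<in> shears" .
  show ?case
    using lower top \<open>0 \<in> shears\<close> by (cases i ?n rule: linorder_cases) (auto simp: coeff_eq_0)
qed

lemma shears_affine: "[:[:d, c:], [:b:]:] \<in> shears"
proof -
  have "subst3 (var_x + const3 b * var_y + const3 c * var_z + const3 d) var_y var_z \<in> H"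
    using Aff3_add_x Aff3_subset by blast
  moreover have "var_x + const3 b * var_y + const3 c * var_z + const3 d = var_x + [:[:[:d, c:], [:b:]:]:]"
    by (simp add: const3_def var_x_def var_y_def var_z_def)
  ultimately show ?thesis by (simp only: shears_def mem_Collect_eq)
qed

lemma shear_y_mem:
  assumes "[:h:] \<in> shears"
  shows "subst3 var_x (var_y + [:[:h:]:]) var_z \<in> H"
proof -
  have s: "subst3 var_y var_x var_z \<in> H" using Aff3_swap_xy Aff3_subset by blast
  have "subst3 (var_x + [:[:h:]:]) var_y var_z \<in> H" using assms by (simp only: shears_def mem_Collect_eq)
  from mem_by_conjugation[OF s this] show ?thesis
    by (simp only: alg_hom_subst3 subst3_simps subst3_var subst3_fix_inner2)
qed

text \<open>The coefficient of \<open>y^n\<close> in \<open>r (y + h)^(n+1)\<close> is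
  \<open>(n+1) r h\<close>, and \<open>n+1\<close> is invertible. The choices \<open>h = 1\<close>,
  \<open>z\<close>, \<open>z^2\<close> are used below.\<close>

lemma shears_lower:
  assumes r: "monom r (Suc n) \<in> shears" and h: "[:h:] \<in> shears"
  shows "monom (r * h) n \<in> shears"
proof -
  have "[:[:h, 1:]:] = var_y + [:[:h:]:]" by (simp add: var_y_def)
  then have "subst3 var_x [:[:h, 1:]:] var_z \<in> H" using shear_y_mem[OF h] by simp
  from shears_pcompose[OF r this] have "monom (coeff (pcompose (monom r (Suc n)) [:h, 1:]) n) n \<in> shears"
    by (rule shears_component)
  moreover have "pcompose (monom r m) [:h, 1:] = smult r ([:h, 1:] ^ m)" for m
    by (induction m) (simp_all add: monom_0 monom_Suc pcompose_pCons del: mult_pCons_left)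
  then have "coeff (pcompose (monom r (Suc n)) [:h, 1:]) n = [:of_nat (Suc n):] * (r * h)"
    by (simp only: coeff_smult coeff_linear_poly_power[of n "Suc n"] le_SucI order_refl)
      (simp add: of_nat_poly algebra_simps del: of_nat_Suc)
  ultimately have "smult [:inverse (of_nat (Suc n)):] (monom ([:of_nat (Suc n):] * (r * h)) n) \<in> shears"
    by (intro shears_smult) simp
  moreover have "smult [:inverse d:] (monom ([:d:] * q) n) = monom q n" if "d \<noteq> 0" for d :: 'a and q
    using that by (simp add: smult_monom)
  ultimately show ?thesis by (metis of_nat_neq_0)
qed

lemma shears_swap:
  assumes "monom r i \<in> shears"
  shows "map_poly (\<lambda>c. monom c i) r \<in> shears"
proof -
  have "subst3 var_x [:[:[:0, 1:]:]:] [:[:0, 1:]:] \<in> H"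
    using Aff3_swap_yz Aff3_subset unfolding var_y_def var_z_def by blast
  from shears_substitute[OF assms this] show ?thesis
    using swap_yz_monom[of var_x r i] unfolding var_y_def var_z_def by blast
qed

abbreviation yz_monom :: "nat \<Rightarrow> nat \<Rightarrow> 'a poly poly"
  where "yz_monom i j \<equiv> monom (monom 1 j) i"

lemma shears_swap_monom: "yz_monom i j \<in> shears \<Longrightarrow> yz_monom j i \<in> shears"
  using shears_swap[of "monom 1 j" i] by (simp add: map_poly_monom)

text \<open>Taking a component in \<open>y\<close>, exchanging the variables and taking a component
  again isolates one monomial.\<close>

lemma shears_monom_of_coeff:
  assumes P: "P \<in> shears" and c: "coeff (coeff P i) j \<noteq> 0"
  shows "yz_monom i j \<in> shears"
proof -
  have "monom (coeff (map_poly (\<lambda>c. monom c i) (coeff P i)) j) j \<in> shears"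
    by (intro shears_component shears_swap P)
  then have "monom (monom (coeff (coeff P i) j) i) j \<in> shears"
    by (simp add: coeff_map_poly)
  from shears_smult[OF this, of "inverse (coeff (coeff P i) j)"] have "yz_monom j i \<in> shears"
    using c by (simp add: smult_monom)
  then show ?thesis by (rule shears_swap_monom)
qed

text \<open>Each use of \<open>shears_lower\<close> with \<open>h = z\<close> trades one factor
  \<open>y\<close> for one factor \<open>z\<close>.\<close>

lemma shears_move:
  assumes "yz_monom (i + k) j \<in> shears"
  shows "yz_monom i (j + k) \<in> shears"
  using assms
proof (induction k arbitrary: j)
  case (Suc k)
  then have "yz_monom (Suc (i + k)) j \<in> shears" by simp
  from shears_lower[OF this, of "[:0, 1:]"] have "yz_monom (i + k) (Suc j) \<in> shears"
    using shears_affine[of 0 1 0] by (simp add: mult.commute[of _ "[:0, 1:]"] monom_Suc)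
  then show ?case using Suc.IH[of "Suc j"] by simp
qed simp

lemma shears_UNIV:
  assumes P: "P \<in> shears" and c: "coeff (coeff P i) j \<noteq> 0" and ij: "i + j \<ge> 2"
  shows "shears = UNIV"
proof -
  \<comment> \<open>With \<open>h = 1\<close> the exponent of \<open>y\<close> drops by one at a
    time, down to 2.\<close>
  have lower: "yz_monom (2 + k) 0 \<in> shears \<Longrightarrow> yz_monom 2 0 \<in> shears" for k
  proof (induction k)
    case (Suc k)
    then have "yz_monom (Suc (2 + k)) 0 \<in> shears" by simp
    from shears_lower[OF this, of 1] have "yz_monom (2 + k) 0 \<in> shears"
      using shears_affine[of 1 0 0] by (simp add: one_pCons)
    then show ?case by (rule Suc.IH)
  qed simp
  have "yz_monom i j \<in> shears" by (rule shears_monom_of_coeff[OF P c])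
  then have "yz_monom 0 (i + j) \<in> shears"
    using shears_move[where i = 0 and k = i and j = j] by (simp add: add.commute)
  then have "yz_monom (2 + (i + j - 2)) 0 \<in> shears" 
    using ij by (metis shears_swap_monom le_add_diff_inverse)
  from shears_swap_monom[OF lower[OF this]] have "yz_monom 0 2 \<in> shears" .
  then have z2: "[:monom 1 2:] \<in> shears" by (simp add: monom_0)
  \<comment> \<open>One round is \<open>y^(n+1) \<mapsto> y^n z^2 \<mapsto> z^(n+2) \<mapsto>
    y^(n+2)\<close>, using \<open>h = z^2\<close>, then \<open>shears_move\<close>, then the
    exchange of variables; it gains one degree.\<close>
  have high: "yz_monom (Suc n) 0 \<in> shears" for n
  proof (induction n)
    case 0
    show ?case using shears_affine[of 0 0 1] by (simp add: monom_Suc monom_0 one_pCons)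
  next
    case (Suc n)
    from shears_lower[OF this z2] have "yz_monom n 2 \<in> shears" by (simp add: mult_monom)
    then have "yz_monom 0 (2 + n) \<in> shears" using shears_move[where i = 0 and k = n and j = 2] by simp
    then have "yz_monom (2 + n) 0 \<in> shears" by (rule shears_swap_monom)
    then show ?case by simp
  qed
  have "yz_monom n 0 \<in> shears" for n
    using high[of "n - 1"] shears_affine[of 1 0 0] by (cases n) (simp_all add: monom_0 one_pCons)
  then have mono: "yz_monom k l \<in> shears" for k l
    using shears_move[where i = k and k = l and j = 0] by simp
  have "Q \<in> shears" for Q
  proof -
    have zero: "0 \<in> shears" by (rule shears_0[OF P])
    have "monom q k \<in> shears" for q k
    proof -
      have "monom q k = (\<Sum>l\<le>degree q. smult [:coeff q l:] (yz_monom k l))"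
        by (subst (1) poly_as_sum_of_monoms[of q, symmetric])
          (rule poly_eqI, simp add: coeff_sum smult_monom)
      also have "\<dots> \<in> shears" by (intro shears_sum zero shears_smult mono)
      finally show ?thesis .
    qed
    then have "(\<Sum>k\<le>degree Q. monom (coeff Q k) k) \<in> shears" by (intro shears_sum zero)
    then show ?thesis by (simp only: poly_as_sum_of_monoms)
  qed
  then show ?thesis by auto
qed

lemma BA3_subset:
  assumes all: "shears = UNIV"
  shows "BA3 \<subseteq> H"
proof
  fix f :: "'a poly3 \<Rightarrow> 'a poly3"
  assume "f \<in> BA3"
  then obtain a p b q c d where f: "f \<in> carrier GA3" and nz: "a \<noteq> 0" "b \<noteq> 0" "c \<noteq> 0"
    and v: "f var_x = const3 a * var_x + [:p:]" "f var_y = const3 b * var_y + [:[:q:]:]"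
      "f var_z = const3 c * var_z + const3 d"
    unfolding BA3_def by blast
  \<comment> \<open>The diagonal factor multiplies the two shear polynomials by \<open>a\<close> and
    \<open>b\<close>, hence the division.\<close>
  let ?p = "smult [:inverse a:] p" and ?q = "smult (inverse b) q"
  have e1: "subst3 (var_x + [:?p:]) var_y var_z \<in> H" using all by (auto simp: shears_def)
  have e2: "subst3 var_x (var_y + [:[:?q:]:]) var_z \<in> H" using all by (intro shear_y_mem) auto
  have e3: "subst3 (const3 a * var_x) (const3 b * var_y) (const3 c * var_z + const3 d) \<in> H"
    using Aff3_diag[OF nz] Aff3_subset by blast
  have "const3 a * [:?p:] = [:p:]" "const3 b * [:[:?q:]:] = [:[:q:]:]"
    using nz smult_1_left[of p] by (simp_all add: const3_def one_pCons)
  with mem_by_comp[OF comp_mem[OF e1 e2] e3, of f] f show "f \<in> H"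
    by (simp only: v GA3_iff comp_apply subst3_simps subst3_var subst3_const3 subst3_fix_inner
        subst3_fix_inner2 distrib_left)
qed

lemma TA3_subset:
  assumes "P \<in> shears" and "coeff (coeff P i) j \<noteq> 0" and "i + j \<ge> 2"
  shows "TA3 \<subseteq> H"
  unfolding TA3_def
  using group.generate_subgroup_incl[OF group_GA3 _ subgroup_H] BA3_subset[OF shears_UNIV[OF assms]] Aff3_subset
  by blast

subsection \<open>Finding a non-affine shear\<close>

text \<open>With \<open>t = (x + y, y, z)\<close> the conjugate \<open>f\<^sup>-\<^sup>1 t f\<close> is a shear in \<open>x\<close>: the part \<open>Q\<close> of
  \<open>f(x)\<close> is fixed by \<open>t\<close> and cancels.\<close>

lemma triangular_imp_TA3_subset:
  assumes f: "f \<in> H" and x: "f var_x = const3 c * var_x + [:Q:]"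
    and y: "f var_y = const3 u * var_y + [:[:s:]:]" and z: "f var_z = var_z"
    and nz: "c \<noteq> 0" "u \<noteq> 0" and deg: "degree s \<ge> 2"
  shows "TA3 \<subseteq> H"
proof -
  note hom = mem_alg_hom[OF f]
  have fs: "f [:[:s:]:] = [:[:s:]:]"
    using alg_hom_eq_inner2[OF hom alg_hom_id] z by simp
  \<comment> \<open>Since \<open>t(f(x)) = f(x) + c y\<close>, the shear polynomial must satisfy
    \<open>f(v) = c y\<close>. The term \<open>s\<close> makes it non-affine.\<close>
  define v where "v = const3 c * (const3 (inverse u) * (var_y - [:[:s:]:]))"
  define P where "P = [:smult (- (c * inverse u)) s, [:c * inverse u:]:]"
  have vP: "[:P:] = v" by (simp add: P_def v_def const3_def var_y_def mult.commute)
  have t: "subst3 (var_x + const3 1 * var_y + const3 0 * var_z + const3 0) var_y var_z \<in> H"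
    using Aff3_add_x Aff3_subset by blast
  have fv: "f v = const3 c * var_y"
    using nz(2)
    by (simp only: v_def alg_hom_simps[OF hom] y fs add_diff_cancel_right' const3_inverse' not_False_eq_True)
  have "subst3 (var_x + v) var_y var_z \<in> H"
    by (rule mem_by_left_cancel[OF f comp_mem[OF t f] alg_hom_subst3];
        simp only: comp_apply subst3_simps subst3_var subst3_const3 alg_hom_simps[OF hom] x y z fv
          subst3_fix_inner subst3_fix_inner2 trivial_coeff_simps distrib_left distrib_right ac_simps)
  then have "P \<in> shears" by (simp only: shears_def mem_Collect_eq vP)
  moreover have "coeff (coeff P 0) (degree s) \<noteq> 0"
    using nz deg by (auto simp: P_def)
  ultimately show ?thesis using deg by (intro TA3_subset[of P 0 "degree s"]) simp_all
qed

text \<open>The quotient \<open>k\<close> of \<open>t \<circ> f\<close> by \<open>f\<close> sends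
  \<open>y\<close> to \<open>y + z p\<close>. It is triangular, and \<open>z p\<close> has degree at
  least 2, so the preceding lemma applies to \<open>k\<close>.\<close>

lemma nonconstant_coeff_imp_TA3_subset:
  assumes f: "f \<in> H" and z: "f var_z = var_z"
    and y: "f var_y = [:[:p:]:] * var_x + [:Q:]" and deg: "degree p \<ge> 1"
  shows "TA3 \<subseteq> H"
proof -
  note hom = mem_alg_hom[OF f]
  let ?p = "[:[:p:]:]"
  have t: "subst3 (var_x + const3 0 * var_y + const3 1 * var_z + const3 0) var_y var_z \<in> H"
    using Aff3_add_x Aff3_subset by blast
  obtain k where k: "k \<in> H"
    and fk: "\<And>q. f (k q) = (subst3 (var_x + const3 0 * var_y + const3 1 * var_z + const3 0) var_y var_z \<circ> f) q"
    using left_quotient[OF f comp_mem[OF t f]] by blast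
  note khom = mem_alg_hom[OF k]
  have fp: "f ?p = ?p"
    using alg_hom_eq_inner2[OF hom alg_hom_id] z by simp
  have kz: "k var_z = var_z"
    by (rule mem_inj[OF f]) (simp only: fk comp_apply z subst3_var)
  have kp: "k ?p = ?p"
    using alg_hom_eq_inner2[OF khom alg_hom_id] kz by simp
  have ky: "k var_y = var_y + var_z * ?p"
    by (rule mem_inj[OF f])
      (simp only: fk comp_apply y z fp alg_hom_simps[OF hom] subst3_simps subst3_var subst3_const3
        subst3_fix_inner subst3_fix_inner2 trivial_coeff_simps distrib_left distrib_right ac_simps)
  \<comment> \<open>Precomposing with this map makes \<open>y\<close> and \<open>z\<close> fixed
    without changing the image of \<open>x\<close>, so the form of \<open>k(x)\<close> can be read
    off.\<close>
  let ?\<tau> = "subst3 var_x (var_y - var_z * ?p) var_z"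
  have \<tau>: "?\<tau> \<in> carrier GA3"
    by (rule subst3_GA3I[of _ _ _ var_x "var_y + var_z * ?p" var_z])
      (simp_all only: subst3_simps subst3_var subst3_fix_inner2 diff_add_cancel add_diff_cancel_right')
  interpret G: group "GA3 :: ('a poly3 \<Rightarrow> 'a poly3) monoid" by (rule group_GA3)
  have "k \<circ> ?\<tau> \<in> carrier GA3"
    using G.m_closed[OF mem_GA3[OF k] \<tau>] by (simp add: GA3_def)
  moreover have "(k \<circ> ?\<tau>) var_y = var_y" "(k \<circ> ?\<tau>) var_z = var_z"
    by (simp_all only: comp_apply subst3_var alg_hom_simps[OF khom] ky kz kp add_diff_cancel_right')
  ultimately obtain u R where u: "u \<noteq> 0" and kx: "(k \<circ> ?\<tau>) var_x = const3 u * var_x + [:R:]"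
    by (rule fix_yz_imp_linear)
  have ky': "k var_y = const3 1 * var_y + [:[:pCons 0 p:]:]"
    unfolding ky by (simp add: const3_simps(2) var_z_def)
  show ?thesis
    by (rule triangular_imp_TA3_subset[OF k _ ky' kz u]) (use kx deg in \<open>auto simp: degree_pCons_eq_if\<close>)
qed

end

section \<open>Translations in \<open>y\<close>, and the form of \<open>\<sigma>(x)\<close> when
  \<open>p\<close> is constant\<close>

lemma coeff_pcompose_translation:
  fixes R :: "'b::comm_ring_1 poly"
  assumes "degree R \<le> Suc m"
  shows "coeff (pcompose R [:h, 1:]) m = coeff R m + of_nat (Suc m) * h * coeff R (Suc m)"
  using assms
proof (induction R arbitrary: m)
  case (pCons a R)
  \<comment> \<open>The next coefficient of \<open>R\<close> vanishes here, so the correction term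
    is absent.\<close>
  have step: "coeff (pcompose R [:h, 1:]) k = coeff R k" if "degree R \<le> k" for k
    using pCons.IH[of k] that by (simp add: coeff_eq_0)
  have "degree R \<le> m" using pCons.prems by (auto simp: degree_pCons_eq_if split: if_splits)
  then show ?case
    using pCons.IH[of "m - 1"] step[of m]
    by (cases m) (simp_all add: pcompose_pCons algebra_simps)
qed simp

text \<open>If \<open>R\<close> has degree \<open>m+1\<close> in \<open>y\<close> and leading
  coefficient \<open>l\<close>, the difference has \<open>y^m\<close>-coefficient
  \<open>(m+1) c z l\<close>, nonzero in characteristic 0. Its top term has total degree at least 2
  unless \<open>m = 0\<close> and \<open>l\<close> is constant, which is excluded.\<close>

lemma translation_difference_nonaffine:
  fixes R :: "'a::field_char_0 poly poly"
  assumes c: "c \<noteq> 0" and R: "\<And>r \<alpha>. R \<noteq> [:r, [:\<alpha>:]:]"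
  shows "\<exists>i j. i + j \<ge> 2 \<and> coeff (coeff (pcompose R [:[:0, c:], 1:] - R) i) j \<noteq> 0"
proof -
  have "degree R \<noteq> 0"
  proof
    assume "degree R = 0"
    then obtain r where "R = [:r:]" by (rule degree_eq_zeroE)
    with R[of r 0] show False by simp
  qed
  then obtain m where m: "degree R = Suc m" by (metis not0_implies_Suc)
  let ?l = "coeff R (Suc m)"
  have l: "?l \<noteq> 0" using m by (metis coeff_0 leading_coeff_0_iff nat.simps(3) degree_0)
  have "coeff (pcompose R [:[:0, c:], 1:] - R) m = of_nat (Suc m) * [:0, c:] * ?l"
    using coeff_pcompose_translation[of R m "[:0, c:]"] m by simp
  also have "\<dots> = pCons 0 (smult (of_nat (Suc m) * c) ?l)"
    by (simp add: of_nat_poly algebra_simps del: of_nat_Suc)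
  finally have "coeff (coeff (pcompose R [:[:0, c:], 1:] - R) m) (Suc (degree ?l)) \<noteq> 0"
    using l c by (simp del: of_nat_Suc)
  moreover have "m + Suc (degree ?l) \<ge> 2"
  proof (rule ccontr)
    assume "\<not> ?thesis"
    then have "m = 0" "degree ?l = 0" by auto
    then obtain \<alpha> where "R = [:coeff R 0, [:\<alpha>:]:]"
      using m by (metis One_nat_def degree1_coeffs degree_eq_zeroE coeff_pCons_0 coeff_pCons_Suc)
    then show False using R by blast
  qed
  ultimately show ?thesis by blast
qed

lemma affine_yz_form:
  assumes "\<And>i j. i + j \<ge> 2 \<Longrightarrow> coeff (coeff Q i) j = 0"
  shows "Q = [:[:coeff (coeff Q 0) 0, coeff (coeff Q 0) 1:], [:coeff (coeff Q 1) 0:]:]"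
proof (rule poly_eqI, rule poly_eqI)
  fix i j
  show "coeff (coeff Q i) j
      = coeff (coeff [:[:coeff (coeff Q 0) 0, coeff (coeff Q 0) 1:], [:coeff (coeff Q 1) 0:]:] i) j"
    using assms[of i j] by (auto simp: coeff_pCons split: nat.split)
qed

text \<open>The automorphism \<open>?\<pi> = (y, c x + Q, z)\<close> takes the values of
  \<open>\<sigma>\<close> at \<open>y\<close> and \<open>z\<close>. Hence \<open>\<rho>\<close>, its
  left quotient of \<open>\<sigma>\<close>, fixes \<open>y\<close> and \<open>z\<close> and sends
  \<open>x\<close> to \<open>u x + R\<close>; applying \<open>?\<pi>\<close> gives the
  claim.\<close>

lemma constant_coeff_form:
  fixes \<sigma> :: "'a::field_char_0 poly3 \<Rightarrow> 'a poly3"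
  assumes \<sigma>: "\<sigma> \<in> carrier GA3" and z: "\<sigma> var_z = var_z"
    and y: "\<sigma> var_y = const3 c * var_x + [:Q:]" and c: "c \<noteq> 0"
  obtains u R where "u \<noteq> 0" "\<sigma> var_x = const3 u * var_y + \<sigma> [:R:]"
proof -
  interpret G: affine_overgroup "carrier (GA3 :: ('a poly3 \<Rightarrow> 'a poly3) monoid)"
    by (rule affine_overgroup.intro) (auto simp: Aff3_def intro: group.subgroup_self group_GA3)
  \<comment> \<open>This is \<open>Q(x,z)\<close>, needed to write down the inverse
    \<open>(inverse c (y - Q(x,z)), x, z)\<close> of \<open>?\<pi>\<close>.\<close>
  define S where "S = subst3 var_y var_x var_z [:Q:]"
  let ?\<pi> = "subst3 var_y (const3 c * var_x + [:Q:]) var_z"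
  let ?\<pi>' = "subst3 (const3 (inverse c) * (var_y - S)) var_x var_z"
  have 1: "?\<pi>' [:Q:] = S"
    unfolding S_def by (rule alg_hom_eq_inner) (simp_all only: alg_hom_subst3 subst3_var)
  have "(?\<pi> \<circ> subst3 var_y var_x var_z) [:Q:] = id [:Q:]"
    by (rule alg_hom_eq_inner[OF alg_hom_comp[OF alg_hom_subst3 alg_hom_subst3] alg_hom_id])
      (simp_all only: subst3_var comp_apply id_apply)
  then have 2: "?\<pi> S = [:Q:]" by (simp only: S_def comp_apply id_apply)
  have \<pi>: "?\<pi> \<in> carrier GA3"
    by (rule subst3_GA3I[of _ _ _ "const3 (inverse c) * (var_y - S)" var_x var_z])
      (use c in \<open>simp_all only: subst3_simps subst3_var subst3_const3 1 2 const3_inverse' add_diff_cancel_right'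
        diff_add_cancel not_False_eq_True\<close>)
  obtain \<rho> where \<rho>: "\<rho> \<in> carrier GA3" and eq: "\<And>p. ?\<pi> (\<rho> p) = \<sigma> p"
    using G.left_quotient[OF \<pi> \<sigma>] by blast
  have \<rho>y: "\<rho> var_y = var_y" and \<rho>z: "\<rho> var_z = var_z"
    by (rule G.mem_inj[OF \<pi>], simp only: eq y z subst3_var)+
  obtain u R where u: "u \<noteq> 0" "\<rho> var_x = const3 u * var_x + [:R:]"
    using fix_yz_imp_linear[OF \<rho> \<rho>y \<rho>z] by blast
  have "\<rho> [:R:] = [:R:]"
    using alg_hom_eq_inner[OF G.mem_alg_hom[OF \<rho>] alg_hom_id] \<rho>y \<rho>z by simp
  then have "\<sigma> var_x = const3 u * var_y + \<sigma> [:R:]"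
    using eq[of var_x] eq[of "[:R:]"] by (simp only: u(2) subst3_simps subst3_var subst3_const3)
  with u(1) that show thesis by blast
qed

context affine_overgroup
begin

lemma constant_coeff_imp_TA3_subset:
  assumes f: "f \<in> H" and z: "f var_z = var_z"
    and y: "f var_y = const3 c * var_x + [:Q:]" and c: "c \<noteq> 0" and nonaff: "f \<notin> Aff3"
  shows "TA3 \<subseteq> H"
proof -
  note hom = mem_alg_hom[OF f]
  obtain u R where u: "u \<noteq> 0" and x: "f var_x = const3 u * var_y + f [:R:]"
    by (rule constant_coeff_form[OF mem_GA3[OF f] z y c])
  show ?thesis
  proof (cases "\<exists>r \<alpha>. R = [:r, [:\<alpha>:]:]")
    case False
    \<comment> \<open>The translation is by \<open>c z\<close> because
      \<open>?t(f(y)) = c (x + z) + Q = f(y + c z)\<close>.\<close>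
    let ?g = "[:[:0, c:], 1:]" and ?R' = "pcompose R [:[:0, c:], 1:]"
    have g: "[:?g:] = var_y + const3 c * var_z" by (simp add: var_y_def var_z_def const3_def)
    have t: "subst3 (var_x + const3 0 * var_y + const3 1 * var_z + const3 0) var_y var_z \<in> H" (is "?t \<in> H")
      using Aff3_add_x Aff3_subset by blast
    have ty: "?t (f var_y) = f (var_y + const3 c * var_z)"
      by (simp only: y z alg_hom_simps[OF hom] subst3_simps subst3_var subst3_const3
        subst3_fix_inner trivial_coeff_simps distrib_left distrib_right ac_simps)
    have "(f \<circ> subst3 var_x [:?g:] var_z) [:R:] = (?t \<circ> f) [:R:]"
      by (rule alg_hom_eq_inner[OF alg_hom_comp[OF hom alg_hom_subst3] alg_hom_comp[OF alg_hom_subst3 hom]])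
        (simp_all only: comp_apply subst3_var z ty g)
    then have tR: "?t (f [:R:]) = f [:?R':]"
      by (simp only: comp_apply subst3_pcompose)
    have fx: "f (var_x + ([:?R':] - [:R:])) = const3 u * var_y + f [:?R':]"
      unfolding alg_hom_simps[OF hom] x by simp
    have tx: "?t (f var_x) = const3 u * var_y + f [:?R':]"
      by (simp only: x subst3_simps subst3_var subst3_const3 tR)
    have \<psi>: "subst3 (var_x + ([:?R':] - [:R:])) (var_y + const3 c * var_z) var_z \<in> H"
      by (rule mem_by_left_cancel[OF f comp_mem[OF t f] alg_hom_subst3])
        (simp_all only: comp_apply subst3_var fx tx ty z)
    have a: "subst3 var_x (var_y + const3 (- c) * var_z + const3 0) var_z \<in> H"
      using Aff3_add_y Aff3_subset by blast
    have "subst3 (var_x + ([:?R':] - [:R:])) var_y var_z \<in> H"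
      by (rule mem_by_comp[OF \<psi> a alg_hom_subst3])
        (simp_all only: subst3_simps subst3_var subst3_const3 const3_simps, simp_all)
    moreover have "[:?R':] - [:R:] = [:?R' - R:]" by simp
    ultimately have "?R' - R \<in> shears" by (simp only: shears_def mem_Collect_eq)
    then show ?thesis
      using translation_difference_nonaffine[OF c, of R] False TA3_subset by blast
  next
    case True
    then obtain r \<alpha> where R: "R = [:r, [:\<alpha>:]:]" by blast
    have "[:R:] = const3 \<alpha> * var_y + [:[:r:]:]" by (simp add: R const3_def var_y_def)
    moreover have "f [:[:r:]:] = [:[:r:]:]"
      using alg_hom_eq_inner2[OF hom alg_hom_id] z by simp
    ultimately have x': "f var_x = const3 u * var_y + const3 \<alpha> * f var_y + [:[:r:]:]"
      by (simp only: x alg_hom_simps[OF hom] add.assoc)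
    show ?thesis
    proof (cases "degree r \<ge> 2")
      case True
      \<comment> \<open>Since \<open>f(x - \<alpha> y) = u y + r\<close>, following this affine map
        by \<open>f\<close> gives the triangular map \<open>(c x + Q, u y + r, z)\<close>.\<close>
      have "subst3 var_y (var_x - const3 \<alpha> * var_y) var_z \<in> Aff3"
        by (rule Aff3_subst3I[of _ _ _ "var_y + const3 \<alpha> * var_x" var_x var_z
              0 1 0 0 1 "- \<alpha>" 0 0 0 0 1 0])
          (simp_all add: lin3_def const3_simps)
      then have a: "subst3 var_y (var_x - const3 \<alpha> * var_y) var_z \<in> H" using Aff3_subset by blast
      have fy: "(f \<circ> subst3 var_y (var_x - const3 \<alpha> * var_y) var_z) var_y = const3 u * var_y + [:[:r:]:]"
        by (simp only: comp_apply subst3_var alg_hom_simps[OF hom] x') simp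
      have fx: "(f \<circ> subst3 var_y (var_x - const3 \<alpha> * var_y) var_z) var_x = const3 c * var_x + [:Q:]"
        by (simp only: comp_apply subst3_var y)
      show ?thesis
        by (rule triangular_imp_TA3_subset[OF comp_mem[OF f a] fx fy _ c u True])
          (simp only: comp_apply subst3_var z)
    next
      case False
      then have "r = [:coeff r 0, coeff r 1:]"
        by (intro poly_eqI) (auto simp: coeff_pCons coeff_eq_0 split: nat.split)
      then obtain \<gamma> \<beta> where r: "r = [:\<gamma>, \<beta>:]" by blast
      have "[:[:r:]:] = const3 \<beta> * var_z + const3 \<gamma>" by (simp add: r const3_def var_z_def)
      with x' have x'': "f var_x = const3 u * var_y + const3 \<alpha> * f var_y + (const3 \<beta> * var_z + const3 \<gamma>)"
        by simp
      show ?thesis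
      proof (cases "\<exists>i j. i + j \<ge> 2 \<and> coeff (coeff Q i) j \<noteq> 0")
        case True
        then obtain i j where ij: "i + j \<ge> 2" "coeff (coeff Q i) j \<noteq> 0" by blast
        \<comment> \<open>The affine form \<open>?w\<close> satisfies \<open>f(?w) = u y\<close>, so
          \<open>f\<close> after the affine map below is the shear by \<open>Q/c\<close>.
          \<open>?v\<close> is the image of \<open>x\<close> under the inverse of that affine
          map.\<close>
        let ?w = "var_x - const3 \<alpha> * var_y - (const3 \<beta> * var_z + const3 \<gamma>)"
        let ?v = "const3 u * var_y + const3 \<alpha> * (const3 c * var_x) + (const3 \<beta> * var_z + const3 \<gamma>)"
        have w: "const3 (inverse u) * ?w
            = lin3 (inverse u) (- (inverse u * \<alpha>)) (- (inverse u * \<beta>)) (- (inverse u * \<gamma>))"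
          by (simp add: lin3_def const3_simps algebra_simps)
        have y_lin: "const3 (inverse c) * var_y = lin3 0 (inverse c) 0 0" and z_lin: "var_z = lin3 0 0 1 0"
          by (simp_all add: lin3_def const3_simps)
        have v_cancel:
          "?v - const3 \<alpha> * (const3 c * var_x) - (const3 \<beta> * var_z + const3 \<gamma>) = const3 u * var_y"
          by simp
        have w_cancel: "?w + const3 \<alpha> * var_y + (const3 \<beta> * var_z + const3 \<gamma>) = var_x"
          by simp
        have "subst3 (const3 (inverse c) * var_y) (const3 (inverse u) * ?w) var_z \<in> Aff3"
          by (rule Aff3_subst3I[of _ _ _ ?v "const3 c * var_x" var_z, OF _ _ _ _ _ _ y_lin w z_lin])
            (use c u in \<open>simp_all only: subst3_simps subst3_var subst3_const3 const3_inverse'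
              v_cancel w_cancel not_False_eq_True\<close>)
        then have a: "subst3 (const3 (inverse c) * var_y) (const3 (inverse u) * ?w) var_z \<in> H"
          using Aff3_subset by blast
        have Q: "const3 (inverse c) * [:Q:] = [:smult [:inverse c:] Q:]" by (simp add: const3_def)
        have fw: "f ?w = const3 u * var_y"
          unfolding alg_hom_simps[OF hom] x'' z by simp
        have "const3 (inverse c) * f var_y = var_x + const3 (inverse c) * [:Q:]"
          using c by (simp only: y distrib_left const3_inverse' not_False_eq_True)
        then have "subst3 (var_x + const3 (inverse c) * [:Q:]) var_y var_z \<in> H"
          by (intro mem_by_comp[OF f a alg_hom_subst3])
            (use u in \<open>simp_all only: subst3_var ring_morphism_mult[OF alg_hom_morphism[OF hom]] alg_hom_const3[OF hom] fw z
              const3_inverse' not_False_eq_True\<close>)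
        then have "smult [:inverse c:] Q \<in> shears" by (simp only: shears_def mem_Collect_eq Q)
        moreover have "coeff (coeff (smult [:inverse c:] Q) i) j \<noteq> 0" using ij c by simp
        ultimately show ?thesis using TA3_subset ij(1) by blast
      next
        case False
        then obtain q0 q1 q2 where "Q = [:[:q0, q1:], [:q2:]:]" using affine_yz_form by metis
        then have "[:Q:] = const3 q2 * var_y + const3 q1 * var_z + const3 q0"
          by (simp add: const3_def var_y_def var_z_def)
        then have y': "f var_y = lin3 c q2 q1 q0" by (simp add: y lin3_def)
        then have "f var_x = lin3 (\<alpha> * c) (u + \<alpha> * q2) (\<beta> + \<alpha> * q1) (\<gamma> + \<alpha> * q0)"
          by (simp add: x'' lin3_def const3_simps algebra_simps)
        moreover have "f var_z = lin3 0 0 1 0" by (simp add: z lin3_def const3_simps)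
        ultimately have "f \<in> Aff3" using y' by (intro Aff3I[OF mem_GA3[OF f]]) blast+
        with nonaff show ?thesis by blast
      qed
    qed
  qed
qed

end

section \<open>Application to the group generated by \<open>\<sigma>\<close> and the affine
  automorphisms\<close>

theorem theorem11:
  fixes \<sigma> :: "'a::field_char_0 poly3 \<Rightarrow> 'a poly3"
  assumes "\<sigma> \<in> carrier GA3 - Aff3"
    and "\<sigma> var_z = var_z"
    and "\<sigma> var_y \<in> R1"
  shows "co_tame \<sigma>"
proof -
  let ?H = "generate GA3 (insert \<sigma> Aff3)"
  have sub: "insert \<sigma> Aff3 \<subseteq> carrier GA3" using assms(1) by (auto simp: Aff3_def)
  interpret affine_overgroup ?H
    by (rule affine_overgroup.intro)
      (auto intro: group.generate_is_subgroup[OF group_GA3 sub] generate.incl)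
  have \<sigma>: "\<sigma> \<in> ?H" by (intro generate.incl) simp
  obtain p Q where p: "p \<noteq> 0" and y: "\<sigma> var_y = [:[:p:]:] * var_x + [:Q:]"
    using assms(3) unfolding R1_def by blast
  have "TA3 \<subseteq> ?H"
  proof (cases "degree p")
    case 0
    then obtain c where "p = [:c:]" by (rule degree_eq_zeroE)
    then show ?thesis
      using constant_coeff_imp_TA3_subset[OF \<sigma> assms(2), of c Q] y p assms(1) by (simp add: const3_def)
  next
    case (Suc n)
    then show ?thesis using nonconstant_coeff_imp_TA3_subset[OF \<sigma> assms(2) y] by simp
  qed
  then show ?thesis using assms(1) by (simp add: co_tame_def)
qed

end
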